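(* For every real $x$ with $0<x<\pi/2$ and every integer $n\geq 3$, \begin{align*} &\left(\frac{(-1)^{n}2^{2n+1}}{(2n+2)!}+\frac{2^{2n+2}(2^{2n+2}-1)|B_{2n+2}|}{(2n+2)!}\right)x^{2n-1}\tan x\\ &\quad<\left(\frac{\sin x}{x}\right)^{2}+\frac{\tan x}{x}-\left\{2+\sum_{k=3}^{n}\left(\frac{(-1)^{k-1}2^{2k-1}}{(2k)!}+\frac{2^{2k}(2^{2k}-1)|B_{2k}|}{(2k)!}\right)x^{2k-2}\right\}\\ &\quad<\left(\frac{2}{\pi}\right)^{2n}x^{2n-1}\tan x. \end{align*}
   Context: $B_n$ ($n\in\mathbb{N}_0=\{0,1,2,\ldots\}$) are the Bernoulli numbers, defined by $\dfrac{t}{e^{t}-1}=\sum_{n=0}^{\infty}B_{n}\dfrac{t^{n}}{n!}$ for $|t|<2\pi$. *)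

theory Defs
  imports "HOL-Complex_Analysis.Complex_Analysis"
begin

text \<open>
  The point \<open>t = 0\<close> is left out because HOL evaluates \<open>t / (exp t - 1)\<close> there to \<open>0\<close>
  instead of the limit \<open>1\<close>; the identity at the remaining points already determines \<open>B\<close>.
\<close>

definition bernoulli :: "nat \<Rightarrow> real" where
  "bernoulli = (THE B. \<forall>t::real. t \<noteq> 0 \<and> \<bar>t\<bar> < 2 * pi \<longrightarrow>
     (\<lambda>n. B n * (t ^ n / fact n)) sums (t / (exp t - 1)))"

lemma bernoulli_generating_function_exists:
  "\<exists>B :: nat \<Rightarrow> real. \<forall>t::real. t \<noteq> 0 \<and> \<bar>t\<bar> < 2 * pi \<longrightarrow>
     (\<lambda>n. B n * (t ^ n / fact n)) sums (t / (exp t - 1))"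
proof -
  define g where "g = (\<lambda>z::complex. if z = 0 then deriv exp 0 else (exp z - exp 0) / (z - 0))"
  define f where "f = (\<lambda>z::complex. 1 / g z)"
  have g_hol: "g holomorphic_on ball 0 (2 * pi)"
    unfolding g_def by (rule pole_lemma_open) (auto intro: holomorphic_intros)
  have g_nz: "g z \<noteq> 0" if "z \<in> ball 0 (2 * pi)" for z
  proof (cases "z = 0")
    case True
    then show ?thesis by (simp add: g_def DERIV_imp_deriv[OF DERIV_exp])
  next
    case False
    have "exp z \<noteq> 1"
    proof
      assume "exp z = 1"
      then obtain k :: int where k: "Re z = 0" "Im z = of_int (2 * k) * pi"
        by (auto simp: exp_eq_1)
      have "\<bar>Im z\<bar> < 2 * pi"
        using that abs_Im_le_cmod[of z] by auto
      then have "\<bar>of_int k :: real\<bar> < 1"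
        using k(2) pi_gt_zero by (simp add: abs_mult)
      then have "k = 0" by linarith
      with k False show False by (simp add: complex_eq_iff)
    qed
    with False show ?thesis by (simp add: g_def)
  qed
  have f_hol: "f holomorphic_on ball 0 (2 * pi)"
    unfolding f_def using g_hol g_nz by (intro holomorphic_intros) auto
  show ?thesis
  proof (intro exI allI impI)
    fix t :: real
    assume t: "t \<noteq> 0 \<and> \<bar>t\<bar> < 2 * pi"
    have "(\<lambda>n. (deriv ^^ n) f 0 / fact n * (of_real t - 0) ^ n) sums f (of_real t)"
      by (rule holomorphic_power_series[OF f_hol]) (use t in auto)
    then have "(\<lambda>n. Re ((deriv ^^ n) f 0 / fact n * (of_real t - 0) ^ n)) sums Re (f (of_real t))"
      by (rule sums_Re)
    moreover have "f (of_real t) = of_real (t / (exp t - 1))"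
      using t by (simp add: f_def g_def exp_of_real)
    moreover have "Re ((deriv ^^ n) f 0 / fact n * (of_real t - 0) ^ n)
        = Re ((deriv ^^ n) f 0) * (t ^ n / fact n)" for n
    proof -
      have "(deriv ^^ n) f 0 / fact n * (of_real t - 0) ^ n
          = (deriv ^^ n) f 0 * complex_of_real (t ^ n / fact n)"
        by simp
      then show ?thesis
        by (simp only: times_complex.sel Re_complex_of_real Im_complex_of_real mult_zero_right diff_zero)
    qed
    ultimately show "(\<lambda>n. Re ((deriv ^^ n) f 0) * (t ^ n / fact n)) sums (t / (exp t - 1))"
      by simp
  qed
qed

lemma bernoulli_generating_function_unique:
  fixes A B :: "nat \<Rightarrow> real"
  assumes A: "\<forall>t::real. t \<noteq> 0 \<and> \<bar>t\<bar> < 2 * pi \<longrightarrow>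
      (\<lambda>n. A n * (t ^ n / fact n)) sums (t / (exp t - 1))"
    and B: "\<forall>t::real. t \<noteq> 0 \<and> \<bar>t\<bar> < 2 * pi \<longrightarrow>
      (\<lambda>n. B n * (t ^ n / fact n)) sums (t / (exp t - 1))"
  shows "A = B"
proof -
  define d where "d = (\<lambda>n. (A n - B n) / fact n)"
  have sums0: "(\<lambda>n. d n * t ^ n) sums 0" if "t \<noteq> 0" "\<bar>t\<bar> < 2 * pi" for t
  proof -
    have "(\<lambda>n. A n * (t ^ n / fact n) - B n * (t ^ n / fact n)) sums
        (t / (exp t - 1) - t / (exp t - 1))"
      using A B that by (intro sums_diff) auto
    then show ?thesis
      by (simp add: d_def field_simps)
  qed
  have "d n = 0" for n
  proof (induction n rule: less_induct)
    case (less n)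
    have tail: "(\<lambda>k. d (k + n) * t ^ k) sums 0" if "t \<noteq> 0" "\<bar>t\<bar> < 2 * pi" for t
    proof -
      have "(\<lambda>k. d (k + n) * t ^ (k + n)) sums 0"
        using sums0[OF that] less.IH by (subst sums_iff_shift) simp
      then have "(\<lambda>k. d (k + n) * t ^ (k + n) / t ^ n) sums (0 / t ^ n)"
        by (rule sums_divide)
      then show ?thesis
        using that(1) by (simp add: power_add)
    qed
    have "((\<lambda>_. 0) \<longlongrightarrow> d (0 + n)) (at (0 :: real))"
    proof (rule powser_limit_0_strong[where a = "\<lambda>k. d (k + n)"])
      show "(0 :: real) < 1" by simp
      show "(\<lambda>k. d (k + n) * t ^ k) sums 0" if "t \<noteq> 0" "norm t < 1" for t
        using that tail[of t] pi_gt3 by auto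
    qed
    then have "d (0 + n) = 0"
      by (metis tendsto_const tendsto_unique trivial_limit_at)
    then show ?case by simp
  qed
  then show ?thesis
    by (auto simp: d_def fun_eq_iff)
qed

lemma bernoulli_sums:
  fixes t :: real
  assumes "t \<noteq> 0" "\<bar>t\<bar> < 2 * pi"
  shows "(\<lambda>n. bernoulli n * (t ^ n / fact n)) sums (t / (exp t - 1))"
proof -
  have "\<exists>!B :: nat \<Rightarrow> real. \<forall>t::real. t \<noteq> 0 \<and> \<bar>t\<bar> < 2 * pi \<longrightarrow>
      (\<lambda>n. B n * (t ^ n / fact n)) sums (t / (exp t - 1))"
    using bernoulli_generating_function_exists bernoulli_generating_function_unique
    by (rule ex_ex1I)
  from theI'[OF this] assms show ?thesis
    unfolding bernoulli_def by blast
qed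

end

theory Submission
  imports Defs "HOL-Real_Asymp.Real_Asymp"
begin

text \<open>
  Both \<open>(sin x / x)\<^sup>2\<close> and \<open>tan x / x\<close> are even power series on \<open>\<bar>x\<bar> < \<pi>/2\<close>, and the middle term
  of the inequality is the tail from index \<open>n\<close> of their sum. The two outer terms are constant
  multiples of \<open>x\<^bsup>2n\<^esup> (tan x / x)\<close>, so both inequalities hold coefficient by coefficient.
  Differentiating the reflection formula of the Gamma function and expanding the Digamma function
  at \<open>1/2\<close> shows that the \<open>k\<close>-th coefficient of \<open>tan x / x\<close> is \<open>2 q\<^bsup>k+1\<^esup> \<lambda>(2k+2)\<close> with
  \<open>q = 4/\<pi>\<^sup>2\<close> and \<open>\<lambda>(s) = 1 + 3\<^bsup>-s\<^esup> + 5\<^bsup>-s\<^esup> + \<dots>\<close>; the Bernoulli numbers enter through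
  \<open>x tanh x\<close>. As \<open>\<lambda>\<close> is decreasing and close to 1, the coefficients of the tangent satisfy
  both comparisons with a margin that absorbs the tiny coefficients of \<open>(sin x / x)\<^sup>2\<close>.
\<close>

section \<open>Odd zeta sums and the values of \<open>Polygamma\<close> at 1/2\<close>

definition odd_zeta :: "nat \<Rightarrow> real" where
  "odd_zeta s = (\<Sum>m. 1 / (2 * real m + 1) ^ s)"

definition tan_coeff :: "nat \<Rightarrow> real" where
  "tan_coeff k = 2 * (4 / pi\<^sup>2) ^ (k + 1) * odd_zeta (2 * k + 2)"

lemma odd_zeta_conv_half:
  "1 / (2 * real m + 1) ^ s = inverse ((1 / 2 + real m) ^ s) / 2 ^ s"
proof -
  have "(2 * real m + 1) ^ s = 2 ^ s * (1 / 2 + real m) ^ s"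
    by (subst power_mult_distrib [symmetric]) (simp add: algebra_simps)
  then show ?thesis by (simp add: field_simps)
qed

lemma odd_zeta_sums:
  assumes "s \<ge> 2"
  shows "(\<lambda>m. 1 / (2 * real m + 1) ^ s) sums odd_zeta s"
proof -
  have "summable (\<lambda>m. inverse ((1 / 2 + real m) ^ s))"
    using Polygamma_converges'[of "1/2 :: real" s] assms by simp
  then show ?thesis
    unfolding odd_zeta_def odd_zeta_conv_half
    by (intro summable_sums summable_divide)
qed

text \<open>Up to the factorial, these are the odd Taylor coefficients of \<open>Digamma\<close> at
  1/2. Doubling every base \<open>1/2 + m\<close> yields the odd numbers and the power of 2; the
  sign in \<open>Polygamma\<close> is positive for odd order.\<close>

lemma Polygamma_half_odd:
  "Polygamma (2 * k + 1) (1 / 2 :: complex)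
     = of_real (fact (2 * k + 1) * 2 ^ (2 * k + 2) * odd_zeta (2 * k + 2))"
proof -
  have "odd_zeta (2 * k + 2)
      = (\<Sum>m. inverse ((1 / 2 + real m) ^ (2 * k + 2))) / 2 ^ (2 * k + 2)"
    unfolding odd_zeta_def odd_zeta_conv_half
    using Polygamma_converges'[of "1/2 :: real" "2 * k + 2"]
    by (intro suminf_divide) simp
  then have "Polygamma (2 * k + 1) (1 / 2 :: real)
      = fact (2 * k + 1) * 2 ^ (2 * k + 2) * odd_zeta (2 * k + 2)"
    by (simp add: Polygamma_def del: fact_Suc power_Suc)
  then show ?thesis
    using Polygamma_of_real[of "1/2" "2 * k + 1", where 'a = complex] by simp
qed

section \<open>Power series of tan and tanh\<close>

text \<open>Both sides of the reflection formula for \<open>rGamma\<close> are differentiated. Off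
  the integers the product of the two \<open>rGamma\<close> values is nonzero and can be divided
  out.\<close>

lemma Digamma_reflection_complex:
  fixes z :: complex
  assumes "z \<notin> \<int>"
  shows "Digamma (1 - z) - Digamma z = pi * cot (pi * z)"
proof -
  have z: "z \<notin> \<int>\<^sub>\<le>\<^sub>0" "1 - z \<notin> \<int>\<^sub>\<le>\<^sub>0"
    using assms nonpos_Ints_Int[of z] nonpos_Ints_Int[of "1 - z"]
      Ints_diff[of 1 "1 - z"] by auto
  have "((\<lambda>z. rGamma z * rGamma (1 - z)) has_field_derivative
      rGamma z * rGamma (1 - z) * (Digamma (1 - z) - Digamma z)) (at z)"
    using z by (auto intro!: derivative_eq_intros simp: algebra_simps)
  moreover have "((\<lambda>z. rGamma z * rGamma (1 - z)) has_field_derivative cos (pi * z)) (at z)"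
    unfolding rGamma_reflection_complex by (auto intro!: derivative_eq_intros)
  ultimately have "rGamma z * rGamma (1 - z) * (Digamma (1 - z) - Digamma z) = cos (pi * z)"
    by (rule DERIV_unique)
  moreover have "rGamma z * rGamma (1 - z) \<noteq> 0"
    using z by (simp add: rGamma_eq_zero_iff)
  then have "sin (pi * z) \<noteq> 0"
    by (auto simp: rGamma_reflection_complex)
  ultimately show ?thesis
    by (simp add: rGamma_reflection_complex cot_def field_simps)
qed

text \<open>With \<open>z = pi * y\<close>, reflection at \<open>1/2 - y\<close> gives
  \<open>pi * tan z = Digamma (1/2 + y) - Digamma (1/2 - y)\<close>. Expanding at 1/2 converges up
  to the pole at 0, which is \<open>norm z < pi / 2\<close>.\<close>

lemma tan_sums_complex:
  fixes z :: complex
  assumes "norm z < pi / 2"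
  shows "(\<lambda>k. of_real (tan_coeff k) * z ^ (2 * k + 1)) sums tan z"
proof -
  define y where "y = z / pi"
  define a :: "nat \<Rightarrow> complex" where "a n = Polygamma n (1 / 2) / fact n" for n
  have y: "norm y < 1 / 2"
    using assms by (simp add: y_def norm_divide field_simps)
  have nz: "w \<notin> \<int>" if "dist (1 / 2) w < 1 / 2" for w :: complex
  proof
    assume "w \<in> \<int>"
    then obtain i :: int where i: "w = of_int i" by (elim Ints_cases)
    have "dist (1 / 2) w = norm (of_real (1 / 2 - of_int i) :: complex)"
      by (simp add: i dist_norm)
    also have "\<dots> = \<bar>1 / 2 - of_int i\<bar>" by (rule norm_of_real)
    finally have "\<bar>1 / 2 - of_int i :: real\<bar> < 1 / 2" using that by simp
    then have "0 < (of_int i :: real)" "(of_int i :: real) < 1"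
      unfolding abs_less_iff by linarith+
    then show False by simp
  qed
  have hol: "Digamma holomorphic_on ball (1 / 2 :: complex) (1 / 2)"
    using nz by (intro holomorphic_intros) (use nonpos_Ints_Int in auto)
  have Digamma_sums: "(\<lambda>n. a n * w ^ n) sums Digamma (1 / 2 + w)" if "norm w < 1 / 2" for w
  proof -
    have "(\<lambda>n. (deriv ^^ n) Digamma (1 / 2) / fact n * (1 / 2 + w - 1 / 2) ^ n)
        sums Digamma (1 / 2 + w)"
      using that by (intro holomorphic_power_series[OF hol]) (simp add: dist_norm)
    moreover have "(1 / 2 :: complex) \<notin> \<int>\<^sub>\<le>\<^sub>0"
      using nz[of "1/2"] nonpos_Ints_Int by auto
    ultimately show ?thesis
      by (simp add: a_def higher_deriv_Polygamma)
  qed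
  have "(\<lambda>n. a n * y ^ n - a n * (- y) ^ n) sums (Digamma (1 / 2 + y) - Digamma (1 / 2 + - y))"
    using y by (intro sums_diff Digamma_sums) simp_all
  also have "Digamma (1 / 2 + y) - Digamma (1 / 2 + - y) = pi * cot (pi * (1 / 2 - y))"
    using Digamma_reflection_complex[of "1/2 - y"] nz[of "1/2 - y"] y
    by (simp add: dist_norm)
  also have "pi * (1 / 2 - y) = of_real pi / 2 - z"
    by (simp add: y_def algebra_simps)
  also have "cot (of_real pi / 2 - z) = tan z"
    by (simp add: cot_def tan_def sin_diff cos_diff)
  finally have "(\<lambda>n. (a n * y ^ n - a n * (- y) ^ n)) sums (pi * tan z)" .
  \<comment> \<open>Even powers of \<open>y\<close> and \<open>- y\<close> agree, so only odd
    indices survive the difference.\<close>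
  moreover have even_if_notin: "even n" if "n \<notin> range (\<lambda>k. 2 * k + 1)" for n :: nat
    using that by (metis oddE rangeI)
  ultimately have "(\<lambda>k. a (2 * k + 1) * y ^ (2 * k + 1) - a (2 * k + 1) * (- y) ^ (2 * k + 1))
      sums (pi * tan z)"
    by (subst sums_mono_reindex [where g = "\<lambda>k. 2 * k + 1"
          and f = "\<lambda>n. a n * y ^ n - a n * (- y) ^ n"])
       (use even_if_notin in \<open>auto simp: strict_mono_def\<close>)
  then have "(\<lambda>k. (a (2 * k + 1) * y ^ (2 * k + 1) - a (2 * k + 1) * (- y) ^ (2 * k + 1)) / pi)
      sums (pi * tan z / pi)"
    by (rule sums_divide)
  moreover have "(a (2 * k + 1) * y ^ (2 * k + 1) - a (2 * k + 1) * (- y) ^ (2 * k + 1)) / pi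
      = of_real (tan_coeff k) * z ^ (2 * k + 1)" for k
  proof -
    \<comment> \<open>The two equal odd terms give the factor 2 of \<open>tan_coeff\<close>;
      \<open>y ^ (2 * k + 1)\<close> and the division by \<open>pi\<close> together give
      \<open>pi ^ (2 * k + 2)\<close>.\<close>
    have "a (2 * k + 1) = of_real (2 ^ (2 * k + 2) * odd_zeta (2 * k + 2))"
      unfolding a_def Polygamma_half_odd by (simp del: fact_Suc power_Suc of_nat_Suc)
    moreover have "(4 / pi\<^sup>2) ^ (k + 1) = 2 ^ (2 * k + 2) / pi ^ (2 * k + 2)"
      by (simp add: power_divide power_mult power2_eq_square)
    ultimately show ?thesis
      by (simp add: tan_coeff_def y_def power_divide mult_ac)
  qed
  ultimately show ?thesis by simp
qed

lemma tan_sums: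
  fixes x :: real
  assumes "\<bar>x\<bar> < pi / 2"
  shows "(\<lambda>k. tan_coeff k * x ^ (2 * k + 1)) sums tan x"
proof -
  have "(\<lambda>k. of_real (tan_coeff k * x ^ (2 * k + 1)) :: complex) sums of_real (tan x)"
    using tan_sums_complex[of "of_real x"] assms by (simp add: tan_of_real)
  then show ?thesis by (simp only: sums_of_real_iff)
qed

text \<open>Since \<open>tanh x = - \<i> * tan (\<i> * x)\<close>, the complex tangent series on the
  imaginary axis gives the same coefficients with alternating signs.\<close>

lemma tanh_sums:
  fixes x :: real
  assumes "\<bar>x\<bar> < pi / 2"
  shows "(\<lambda>k. (-1) ^ k * tan_coeff k * x ^ (2 * k + 1)) sums tanh x"
proof -
  have "(\<lambda>k. - \<i> * (of_real (tan_coeff k) * (\<i> * of_real x) ^ (2 * k + 1)))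
      sums (- \<i> * tan (\<i> * of_real x))"
    using assms by (intro sums_mult tan_sums_complex) (simp add: norm_mult)
  moreover have "- \<i> * (of_real (tan_coeff k) * (\<i> * of_real x) ^ (2 * k + 1))
      = of_real ((-1) ^ k * tan_coeff k * x ^ (2 * k + 1))" for k
  proof -
    have "(\<i> * of_real x) ^ (2 * k + 1) = \<i> * of_real ((-1) ^ k * x ^ (2 * k + 1))"
      by (simp add: power_mult_distrib power_mult [of \<i>])
    moreover have "- \<i> * (a * (\<i> * b)) = a * b" for a b :: complex
      by (simp add: complex_eq_iff algebra_simps)
    ultimately show ?thesis
      by (simp only:) (simp add: mult_ac)
  qed
  moreover have "- \<i> * tan (\<i> * of_real x) = of_real (tanh x)"
    unfolding tanh_conv_tan [symmetric]
    by (simp only: tanh_altdef of_real_divide of_real_diff of_real_add of_real_minus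
          exp_of_real [symmetric])
  ultimately have "(\<lambda>k. of_real ((-1) ^ k * tan_coeff k * x ^ (2 * k + 1)) :: complex)
      sums of_real (tanh x)"
    by (simp only:)
  then show ?thesis by (simp only: sums_of_real_iff)
qed

section \<open>Bernoulli numbers as tangent coefficients\<close>

text \<open>Once the lower coefficients vanish, dividing by \<open>t ^ n\<close> leaves a series
  with constant term \<open>d n\<close> and limit 0. The point 0 is excluded to match
  \<open>bernoulli_sums\<close>.\<close>

lemma powser_coeff_zero:
  fixes d :: "nat \<Rightarrow> real"
  assumes "r > 0" and sums: "\<And>t. t \<noteq> 0 \<Longrightarrow> \<bar>t\<bar> < r \<Longrightarrow> (\<lambda>n. d n * t ^ n) sums 0"
  shows "d n = 0"
proof (induction n rule: less_induct)
  case (less n)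
  have "(\<lambda>k. d (k + n) * t ^ k) sums 0" if "t \<noteq> 0" "\<bar>t\<bar> < r" for t
  proof -
    have "(\<lambda>k. d (k + n) * t ^ (k + n)) sums 0"
      using sums[OF that] less.IH by (subst sums_iff_shift) simp
    then have "(\<lambda>k. inverse (t ^ n) * (d (k + n) * t ^ (k + n))) sums (inverse (t ^ n) * 0)"
      by (rule sums_mult)
    then show ?thesis
      using that(1) by (simp add: power_add field_simps)
  qed
  then have "((\<lambda>_. 0) \<longlongrightarrow> d (0 + n)) (at (0 :: real))"
    using \<open>r > 0\<close> by (intro powser_limit_0_strong[where a = "\<lambda>k. d (k + n)" and s = r]) auto
  then show ?case
    by (metis LIM_unique add_0 tendsto_const)
qed

text \<open>
  With \<open>g t = t / (exp t - 1)\<close>, which generates the Bernoulli numbers, \<open>t tanh t = t + g (4 t) - g (2 t)\<close>.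
\<close>
lemma bernoulli_even_eq_tan_coeff:
  "2 ^ (2 * k + 2) * (2 ^ (2 * k + 2) - 1) * bernoulli (2 * k + 2) / fact (2 * k + 2)
     = (-1) ^ k * tan_coeff k"
proof -
  \<comment> \<open>\<open>a\<close> and \<open>b\<close> are two expansions of
    \<open>t * tanh t\<close>, one from the tangent and one from the Bernoulli generating function;
    the 1 in \<open>b\<close> at index 1 is the summand \<open>t\<close> of the identity.\<close>
  define a where "a n = (if even n \<and> n \<noteq> 0 then (-1) ^ ((n - 2) div 2) * tan_coeff ((n - 2) div 2)
    else 0)" for n :: nat
  define b where "b n = (if n = 1 then 1 else 0) + (4 ^ n - 2 ^ n) * bernoulli n / fact n" for n
  have a: "(\<lambda>n. a n * t ^ n) sums (t * tanh t)" if "\<bar>t\<bar> < pi / 2" for t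
  proof -
    have "(\<lambda>k. t * ((-1) ^ k * tan_coeff k * t ^ (2 * k + 1))) sums (t * tanh t)"
      using that by (intro sums_mult tanh_sums)
    then have "(\<lambda>k. a (2 * k + 2) * t ^ (2 * k + 2)) sums (t * tanh t)"
      by (simp add: a_def mult_ac)
    moreover have "n \<in> range (\<lambda>k. 2 * k + 2)" if "even n" "n \<noteq> 0" for n :: nat
      using that by (intro range_eqI[of _ _ "n div 2 - 1"]) (auto elim!: evenE)
    ultimately show ?thesis
      by (subst (asm) sums_mono_reindex [where g = "\<lambda>k. 2 * k + 2"])
         (auto simp: strict_mono_def a_def)
  qed
  have b: "(\<lambda>n. b n * t ^ n) sums (t * tanh t)" if "t \<noteq> 0" "\<bar>t\<bar> < pi / 2" for t
  proof -
    have "(\<lambda>n. (if n = 1 then t ^ n else 0)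
          + (bernoulli n * ((4 * t) ^ n / fact n) - bernoulli n * ((2 * t) ^ n / fact n)))
        sums (t ^ 1 + (4 * t / (exp (4 * t) - 1) - 2 * t / (exp (2 * t) - 1)))"
      \<comment> \<open>The condition \<open>\<bar>4 * t\<bar> < 2 * pi\<close> is exactly
        \<open>\<bar>t\<bar> < pi / 2\<close>.\<close>
      using that by (intro sums_add sums_diff bernoulli_sums sums_single) auto
    moreover have "(\<lambda>n. (if n = 1 then t ^ n else 0)
          + (bernoulli n * ((4 * t) ^ n / fact n) - bernoulli n * ((2 * t) ^ n / fact n)))
        = (\<lambda>n. b n * t ^ n)"
      by (auto simp: b_def power_mult_distrib field_simps fun_eq_iff)
    moreover have "t ^ 1 + (4 * t / (exp (4 * t) - 1) - 2 * t / (exp (2 * t) - 1)) = t * tanh t"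
    proof -
      define E where "E = exp (2 * t)"
      have E: "E > 0" "E \<noteq> 1" using that by (auto simp: E_def)
      have "exp (4 * t) - 1 = (E - 1) * (E + 1)"
        by (simp add: E_def algebra_simps flip: exp_add)
      then have "t ^ 1 + (4 * t / (exp (4 * t) - 1) - 2 * t / (exp (2 * t) - 1))
          = t + (4 * t / ((E - 1) * (E + 1)) - 2 * t / (E - 1))"
        by (simp add: E_def)
      also have "\<dots> = t * ((E - 1) / (E + 1))"
        using E by (simp add: divide_simps) (simp add: algebra_simps)
      also have "(E - 1) / (E + 1) = (1 - 1 / E) / (1 + 1 / E)"
        using E by (simp add: divide_simps)
      also have "1 / E = exp (- 2 * t)"
        by (simp add: E_def exp_minus field_simps)
      finally show ?thesis
        by (simp only: tanh_real_altdef)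
    qed
    ultimately show ?thesis by simp
  qed
  have "b n - a n = 0" for n
  proof (rule powser_coeff_zero[where r = "pi / 2"])
    show "(\<lambda>n. (b n - a n) * t ^ n) sums 0" if "t \<noteq> 0" "\<bar>t\<bar> < pi / 2" for t
      using sums_diff[OF b[OF that] a[OF that(2)]] by (simp add: algebra_simps)
  qed simp
  from this[of "2 * k + 2"] have "b (2 * k + 2) = (-1) ^ k * tan_coeff k"
    by (simp add: a_def)
  moreover have "(4 :: real) ^ n - 2 ^ n = 2 ^ n * (2 ^ n - 1)" for n
    by (simp add: algebra_simps flip: power_mult_distrib)
  ultimately show ?thesis
    by (simp add: b_def del: power_Suc fact_Suc)
qed

lemma odd_zeta_nonneg: "s \<ge> 2 \<Longrightarrow> odd_zeta s \<ge> 0"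
  by (rule sums_le[OF _ sums_zero odd_zeta_sums]) auto

text \<open>The zeta form shows that \<open>tan_coeff k\<close> is nonnegative, so absolute values
  just remove the sign \<open>(-1) ^ k\<close>.\<close>

lemma abs_bernoulli_even_eq_tan_coeff:
  "2 ^ (2 * k + 2) * (2 ^ (2 * k + 2) - 1) * \<bar>bernoulli (2 * k + 2)\<bar> / fact (2 * k + 2) = tan_coeff k"
proof -
  define c :: real where "c = 2 ^ (2 * k + 2) * (2 ^ (2 * k + 2) - 1) / fact (2 * k + 2)"
  have "c \<ge> 0"
    unfolding c_def by (intro divide_nonneg_nonneg mult_nonneg_nonneg) (simp_all del: power_Suc)
  moreover have "tan_coeff k \<ge> 0"
    by (simp add: tan_coeff_def odd_zeta_nonneg)
  moreover have "c * bernoulli (2 * k + 2) = (-1) ^ k * tan_coeff k"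
    using bernoulli_even_eq_tan_coeff[of k] by (simp add: c_def)
  then have "\<bar>c * bernoulli (2 * k + 2)\<bar> = \<bar>(-1) ^ k * tan_coeff k\<bar>"
    by (rule arg_cong)
  ultimately have "c * \<bar>bernoulli (2 * k + 2)\<bar> = tan_coeff k"
    by (simp add: abs_mult)
  then show ?thesis by (simp add: c_def)
qed

section \<open>First tangent coefficients and the series of the squared sine quotient\<close>

text \<open>Interleaving zeros turns the even series into an ordinary one. This reads off tangent
  coefficients from limits at 0.\<close>

lemma even_powser_limit_0:
  fixes c :: "nat \<Rightarrow> real"
  assumes "r > 0" and sums: "\<And>t. t \<noteq> 0 \<Longrightarrow> \<bar>t\<bar> < r \<Longrightarrow> (\<lambda>k. c k * t ^ (2 * k)) sums f t"
  shows "(f \<longlongrightarrow> c 0) (at 0)"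
proof -
  define a where "a n = (if even n then c (n div 2) else 0)" for n
  have "(\<lambda>n. a n * t ^ n) sums f t" if "t \<noteq> 0" "\<bar>t\<bar> < r" for t
  proof -
    have "(\<lambda>k. a (2 * k) * t ^ (2 * k)) sums f t"
      using sums[OF that] by (simp add: a_def)
    then show ?thesis
      by (subst (asm) sums_mono_reindex [where g = "\<lambda>k. 2 * k"])
         (auto simp: strict_mono_def a_def)
  qed
  then have "(f \<longlongrightarrow> a 0) (at 0)"
    using \<open>r > 0\<close> by (intro powser_limit_0_strong[where a = a and s = r]) auto
  then show ?thesis by (simp add: a_def)
qed

lemma tan_over_sums:
  fixes x :: real
  assumes "x \<noteq> 0" "\<bar>x\<bar> < pi / 2"
  shows "(\<lambda>k. tan_coeff k * x ^ (2 * k)) sums (tan x / x)"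
  using sums_divide[OF tan_sums[OF assms(2)], of x] assms(1) by simp

lemma tan_coeff_0 [simp]: "tan_coeff 0 = 1"
proof (rule LIM_unique)
  show "((\<lambda>x. tan x / x) \<longlongrightarrow> tan_coeff 0) (at 0)"
    by (rule even_powser_limit_0[where r = "pi / 2"]) (auto intro: tan_over_sums)
  show "((\<lambda>x::real. tan x / x) \<longlongrightarrow> 1) (at 0)"
    unfolding tan_def by real_asymp
qed

lemma tan_coeff_1: "tan_coeff 1 = 1 / 3"
proof (rule LIM_unique)
  have "((\<lambda>x. (tan x / x - 1) / x\<^sup>2) \<longlongrightarrow> tan_coeff (Suc 0)) (at 0)"
  proof (rule even_powser_limit_0[where r = "pi / 2"])
    fix x :: real assume x: "x \<noteq> 0" "\<bar>x\<bar> < pi / 2"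
    have "(\<lambda>k. tan_coeff (Suc k) * x ^ (2 * Suc k)) sums (tan x / x - 1)"
      using tan_over_sums[OF x] by (subst sums_Suc_iff) simp
    from sums_divide[OF this, of "x\<^sup>2"]
    show "(\<lambda>k. tan_coeff (Suc k) * x ^ (2 * k)) sums ((tan x / x - 1) / x\<^sup>2)"
      using x by (simp add: power2_eq_square)
  qed simp
  then show "((\<lambda>x. (tan x / x - 1) / x\<^sup>2) \<longlongrightarrow> tan_coeff 1) (at 0)" by simp
  show "((\<lambda>x::real. (tan x / x - 1) / x\<^sup>2) \<longlongrightarrow> 1 / 3) (at 0)"
    unfolding tan_def by real_asymp
qed

definition sin2_coeff :: "nat \<Rightarrow> real" where
  "sin2_coeff k = (-1) ^ k * 2 ^ (2 * k + 1) / fact (2 * k + 2)"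

text \<open>From \<open>cos (2 * x) - 1 = - 2 * (sin x)\<^sup>2\<close>: the cosine series loses its
  constant term and is divided by \<open>- 2 * x\<^sup>2\<close>.\<close>

lemma sin2_over_sums:
  fixes x :: real
  assumes "x \<noteq> 0"
  shows "(\<lambda>k. sin2_coeff k * x ^ (2 * k)) sums (sin x / x)\<^sup>2"
proof -
  have "(\<lambda>k. (-1) ^ Suc k / fact (2 * Suc k) * (2 * x) ^ (2 * Suc k)) sums (cos (2 * x) - 1)"
    using cos_paired[of "2 * x"] by (subst sums_Suc_iff) simp
  from sums_divide[OF this, of "- 2 * x\<^sup>2"]
  have "(\<lambda>k. (-1) ^ Suc k / fact (2 * Suc k) * (2 * x) ^ (2 * Suc k) / (- 2 * x\<^sup>2))
      sums ((cos (2 * x) - 1) / (- 2 * x\<^sup>2))" .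
  moreover have "(-1) ^ Suc k / fact (2 * Suc k) * (2 * x) ^ (2 * Suc k) / (- 2 * x\<^sup>2)
      = sin2_coeff k * x ^ (2 * k)" for k
    using assms
    by (simp add: sin2_coeff_def power_mult_distrib power2_eq_square divide_simps del: fact_Suc)
  moreover have "(cos (2 * x) - 1) / (- 2 * x\<^sup>2) = (sin x / x)\<^sup>2"
    using assms by (simp add: cos_double_sin power_divide)
  ultimately show ?thesis by simp
qed

section \<open>Numerical bounds on odd zeta sums and sine coefficients\<close>

lemma odd_zeta_2: "odd_zeta 2 = pi\<^sup>2 / 8"
  using tan_coeff_0 by (simp add: tan_coeff_def field_simps numeral_2_eq_2)

lemma odd_zeta_ge_1: "s \<ge> 2 \<Longrightarrow> odd_zeta s \<ge> 1"
  using sum_le_suminf[OF sums_summable[OF odd_zeta_sums], of s "{0}"] by (simp add: odd_zeta_def)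

text \<open>After the leading 1 every base is at least 3, so each term is at most 1/9 of the
  matching term of \<open>odd_zeta 2\<close>, whose tail is known exactly.\<close>

lemma odd_zeta_le:
  assumes "s \<ge> 4"
  shows "odd_zeta s \<le> 1 + (pi\<^sup>2 / 8 - 1) / 9"
proof -
  have "(\<lambda>m. 1 / (2 * real (Suc m) + 1) ^ s) sums (odd_zeta s - 1)"
    using odd_zeta_sums[of s] assms by (subst sums_Suc_iff) simp
  moreover have "(\<lambda>m. 1 / (2 * real (Suc m) + 1)\<^sup>2) sums (pi\<^sup>2 / 8 - 1)"
    using odd_zeta_sums[of 2] odd_zeta_2 by (subst sums_Suc_iff) simp
  then have "(\<lambda>m. 1 / (2 * real (Suc m) + 1)\<^sup>2 / 9) sums ((pi\<^sup>2 / 8 - 1) / 9)"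
    by (rule sums_divide)
  moreover have "1 / (2 * real (Suc m) + 1) ^ s \<le> 1 / (2 * real (Suc m) + 1)\<^sup>2 / 9" for m
  proof -
    define d where "d = 2 * real (Suc m) + 1"
    have d: "d \<ge> 3" by (simp add: d_def)
    have "d\<^sup>2 * 9 \<le> d\<^sup>2 * d\<^sup>2"
      using power_mono[OF d, of 2] by (intro mult_left_mono) auto
    also have "\<dots> = d ^ 4" by (simp flip: power_add)
    also have "\<dots> \<le> d ^ s"
      using d assms by (intro power_increasing) auto
    finally have "1 / d ^ s \<le> 1 / (d\<^sup>2 * 9)"
      using d by (intro divide_left_mono) auto
    then show ?thesis by (simp add: d_def)
  qed
  ultimately have "odd_zeta s - 1 \<le> (pi\<^sup>2 / 8 - 1) / 9"
    by (intro sums_le[OF _ \<open>_ sums (odd_zeta s - 1)\<close>])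
  then show ?thesis by linarith
qed

text \<open>All termwise differences are nonnegative; only the one at base 3 is kept, the terms at
  base 1 cancelling.\<close>

lemma odd_zeta_diff_ge:
  assumes "s \<ge> 2"
  shows "1 / 3 ^ s - 1 / 3 ^ (s + i) \<le> odd_zeta s - odd_zeta (s + i)"
proof -
  define d where "d m = 1 / (2 * real m + 1) ^ s - 1 / (2 * real m + 1) ^ (s + i)" for m
  have sums: "d sums (odd_zeta s - odd_zeta (s + i))"
    unfolding d_def using assms by (intro sums_diff odd_zeta_sums) auto
  have "d m \<ge> 0" for m
    unfolding d_def by (simp add: divide_left_mono power_increasing)
  then have "sum d {1} \<le> suminf d"
    using sums by (intro sum_le_suminf) (auto simp: sums_iff)
  then show ?thesis
    using sums by (simp add: sums_iff d_def)
qed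

lemma pi_sq_bounds: "9.8 < pi\<^sup>2" "pi\<^sup>2 < 9.9"
proof -
  have "3.14 * 3.14 \<le> pi * pi"
    using pi_approx by (intro mult_mono) auto
  moreover have "pi * pi \<le> 3.142 * 3.142"
    using pi_approx by (intro mult_mono) auto
  ultimately show "9.8 < pi\<^sup>2" "pi\<^sup>2 < 9.9"
    by (simp_all add: power2_eq_square)
qed

text \<open>Each step multiplies the left side by \<open>a\<close> and the right side by
  \<open>(2 * m + 1) * (2 * m + 2)\<close>, which is at least \<open>9 * 10\<close> for
  \<open>m \<ge> 4\<close>; hence the bound 90.\<close>

lemma power_le_fact_double:
  fixes a b :: real
  assumes "0 \<le> a" "a \<le> 90" "0 \<le> b" "b * a ^ 4 \<le> fact 8" "m \<ge> 4"
  shows "b * a ^ m \<le> fact (2 * m)"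
  using \<open>m \<ge> 4\<close>
proof (induction m rule: dec_induct)
  case base
  then show ?case using assms by simp
next
  case (step m)
  have "b * a ^ Suc m = (b * a ^ m) * a" by simp
  also have "\<dots> \<le> fact (2 * m) * (real (2 * m + 1) * real (2 * m + 2))"
  proof (intro mult_mono)
    have "9 * 10 \<le> real (2 * m + 1) * real (2 * m + 2)"
      using step.hyps by (intro mult_mono) auto
    then show "a \<le> real (2 * m + 1) * real (2 * m + 2)"
      using assms by simp
  qed (use step assms in auto)
  also have "\<dots> = fact (2 * Suc m)" by (simp add: algebra_simps)
  finally show ?case .
qed

lemma abs_sin2_coeff: "\<bar>sin2_coeff k\<bar> = 2 ^ (2 * k + 1) / fact (2 * k + 2)"
  by (simp add: sin2_coeff_def abs_mult)

lemma abs_sin2_coeff_le: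
  assumes "k \<ge> 3"
  shows "\<bar>sin2_coeff k\<bar> \<le> (4 / pi\<^sup>2) ^ (k + 1) / 8"
proof -
  have "4 * (pi\<^sup>2) ^ 4 \<le> 4 * 9.9 ^ 4"
    using pi_sq_bounds by (intro mult_left_mono power_mono) auto
  also have "\<dots> \<le> fact 8" by (simp add: fact_numeral power_divide)
  finally have "4 * (pi\<^sup>2) ^ (k + 1) \<le> fact (2 * (k + 1))"
    using pi_sq_bounds assms by (intro power_le_fact_double) auto
  moreover have "(2 :: real) ^ (2 * k + 1) * 2 = 4 ^ (k + 1)"
    by (simp add: power_mult)
  ultimately show ?thesis
    by (simp add: abs_sin2_coeff field_simps del: fact_Suc)
qed

text \<open>The number 728 is \<open>9 ^ 3 - 1\<close>, the least value of \<open>9 ^ n - 1\<close>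
  for \<open>n \<ge> 3\<close>, as \<open>mid_coeff_upper\<close> requires.\<close>

lemma abs_sin2_coeff_less:
  assumes "k \<ge> 3"
  shows "\<bar>sin2_coeff k\<bar> < 2 * 728 * (4 / (9 * pi\<^sup>2)) ^ (k + 1)"
proof -
  \<comment> \<open>The constant 2000 lies below \<open>4 * 728\<close> and is large enough for the
    base case against \<open>fact 8\<close>.\<close>
  have "1 / 2000 * (9 * pi\<^sup>2) ^ 4 \<le> 1 / 2000 * (9 * 9.9) ^ 4"
    using pi_sq_bounds by (intro mult_left_mono power_mono) auto
  also have "\<dots> \<le> fact 8" by (simp add: fact_numeral power_divide)
  finally have "1 / 2000 * (9 * pi\<^sup>2) ^ (k + 1) \<le> fact (2 * (k + 1))"
    using pi_sq_bounds assms by (intro power_le_fact_double) auto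
  then have "(9 * pi\<^sup>2) ^ (k + 1) < 4 * 728 * fact (2 * (k + 1))"
    using fact_gt_zero[of "2 * (k + 1)", where 'a = real] by linarith
  then have *: "4 ^ (k + 1) * (9 * pi\<^sup>2) ^ (k + 1) < 4 ^ (k + 1) * (4 * 728 * fact (2 * (k + 1)))"
    by (rule mult_strict_left_mono) simp
  have "(2 :: real) ^ (2 * k + 1) = 4 ^ (k + 1) / 2"
    by (simp add: power_mult)
  then have "\<bar>sin2_coeff k\<bar> = 4 ^ (k + 1) / 2 / fact (2 * (k + 1))"
    unfolding abs_sin2_coeff by (simp only: distrib_left mult_1_right)
  also have "\<dots> < 2 * 728 * (4 ^ (k + 1) / (9 * pi\<^sup>2) ^ (k + 1))"
    using * by (simp add: divide_simps mult_ac del: fact_Suc power_Suc)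
  finally show ?thesis by (simp only: power_divide)
qed

section \<open>Coefficientwise comparison\<close>

text \<open>
  The index is shifted by one against the informal statement: \<open>mid_coeff k\<close> belongs to \<open>x\<^bsup>2k\<^esup>\<close>,
  i.e. to the summand with \<open>B\<^bsub>2k+2\<^esub>\<close>. It vanishes for \<open>k = 1\<close>, which is why the sum in the
  theorem starts at 3.
\<close>
definition mid_coeff :: "nat \<Rightarrow> real" where
  "mid_coeff k = sin2_coeff k + tan_coeff k"

text \<open>The product on the left carries one more factor \<open>q = 4 / pi\<^sup>2 < 0.41\<close>
  than the right side, which outweighs the constants. At \<open>j = 0\<close> both sides agree
  because \<open>tan_coeff 0 = 1\<close>.\<close>

lemma mid_coeff_lower:
  assumes "n \<ge> 3" "j \<ge> 1"
  shows "mid_coeff n * tan_coeff j < mid_coeff (n + j)"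
proof -
  define q where "q = 4 / pi\<^sup>2"
  have q: "q > 0" "q < 0.41"
    using pi_sq_bounds by (auto simp: q_def field_simps)
  have tan_le: "tan_coeff k \<le> q ^ (k + 1) * 2.07" if "k \<ge> 1" for k
  proof -
    have "odd_zeta (2 * k + 2) \<le> 1.035"
    proof -
      have "odd_zeta (2 * k + 2) \<le> 1 + (pi\<^sup>2 / 8 - 1) / 9"
        using that by (intro odd_zeta_le) simp
      also have "\<dots> \<le> 1.035"
        using pi_sq_bounds by simp
      finally show ?thesis .
    qed
    then have "q ^ (k + 1) * (2 * odd_zeta (2 * k + 2)) \<le> q ^ (k + 1) * 2.07"
      using q by (intro mult_left_mono) auto
    then show ?thesis by (simp add: tan_coeff_def q_def mult_ac)
  qed
  have tan_ge: "q ^ (k + 1) * 2 \<le> tan_coeff k" for k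
  proof -
    have "q ^ (k + 1) * 2 \<le> q ^ (k + 1) * (2 * odd_zeta (2 * k + 2))"
      using q odd_zeta_ge_1[of "2 * k + 2"] by (intro mult_left_mono) auto
    then show ?thesis by (simp add: tan_coeff_def q_def mult_ac)
  qed
  have sin: "\<bar>sin2_coeff k\<bar> \<le> q ^ (k + 1) / 8" if "k \<ge> 3" for k
    using abs_sin2_coeff_le[OF that] by (simp add: q_def)
  \<comment> \<open>Here \<open>2.195 = 2.07 + 1/8\<close>; below, \<open>1.875 = 2 - 1/8\<close>,
    with 1/8 from the sine coefficient. The margin is
    \<open>0.41 * 2.195 * 2.07 < 1.875\<close>.\<close>
  have "mid_coeff n * tan_coeff j \<le> (q ^ (n + 1) * 2.195) * (q ^ (j + 1) * 2.07)"
  proof (intro mult_mono)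
    show "mid_coeff n \<le> q ^ (n + 1) * 2.195"
      using sin[of n] tan_le[of n] assms by (simp add: mid_coeff_def)
    have "q ^ (j + 1) > 0" using q by simp
    then show "0 \<le> tan_coeff j" using tan_ge[of j] by linarith
  qed (use tan_le[of j] assms q in auto)
  also have "\<dots> = q ^ (n + j + 1) * (q * 4.54365)"
    by (simp add: power_add)
  also have "\<dots> < q ^ (n + j + 1) * 1.875"
    using q by (intro mult_strict_left_mono) auto
  also have "\<dots> \<le> mid_coeff (n + j)"
    using sin[of "n + j"] tan_ge[of "n + j"] assms by (simp add: mid_coeff_def)
  finally show ?thesis .
qed

text \<open>Both tangent terms carry the same power of \<open>q\<close>, so their gap is a
  difference of odd zeta sums. Its base-3 term already exceeds the sine coefficient.\<close>

lemma mid_coeff_upper: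
  assumes "n \<ge> 3"
  shows "mid_coeff (n + j) < (4 / pi\<^sup>2) ^ n * tan_coeff j"
proof -
  define q where "q = 4 / pi\<^sup>2"
  have q: "q > 0" by (simp add: q_def)
  have "q ^ n * tan_coeff j - tan_coeff (n + j)
      = 2 * q ^ (n + j + 1) * (odd_zeta (2 * j + 2) - odd_zeta (2 * j + 2 + 2 * n))"
    by (simp add: tan_coeff_def q_def [symmetric] power_add algebra_simps)
  also have "\<dots> \<ge> 2 * q ^ (n + j + 1) * (1 / 3 ^ (2 * j + 2) - 1 / 3 ^ (2 * j + 2 + 2 * n))"
    using q by (intro mult_left_mono odd_zeta_diff_ge) auto
  also have "1 / 3 ^ (2 * j + 2) - 1 / 3 ^ (2 * j + 2 + 2 * n) = (9 ^ n - 1) / (9 :: real) ^ (n + j + 1)"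
  proof -
    have "(3 :: real) ^ (2 * j + 2) = 9 ^ (j + 1)" "(3 :: real) ^ (2 * j + 2 + 2 * n) = 9 ^ (n + j + 1)"
      by (simp_all add: power_add power_mult)
    then show ?thesis by (simp add: power_add field_simps)
  qed
  also have "2 * q ^ (n + j + 1) * ((9 ^ n - 1) / 9 ^ (n + j + 1))
      = 2 * (9 ^ n - 1) * (4 / (9 * pi\<^sup>2)) ^ (n + j + 1)"
    by (simp add: q_def power_divide power_mult_distrib algebra_simps)
  finally have "2 * (9 ^ n - 1) * (4 / (9 * pi\<^sup>2)) ^ (n + j + 1)
      \<le> q ^ n * tan_coeff j - tan_coeff (n + j)" .
  moreover have "2 * 728 * (4 / (9 * pi\<^sup>2)) ^ (n + j + 1)
      \<le> 2 * (9 ^ n - 1) * (4 / (9 * pi\<^sup>2)) ^ (n + j + 1)"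
    using power_increasing[OF assms, of "9 :: real"] by (intro mult_right_mono) auto
  moreover have "\<bar>sin2_coeff (n + j)\<bar> < 2 * 728 * (4 / (9 * pi\<^sup>2)) ^ (n + j + 1)"
    using assms by (intro abs_sin2_coeff_less) auto
  ultimately show ?thesis
    unfolding mid_coeff_def q_def by linarith
qed

section \<open>Summing the comparisons\<close>

lemma sums_less:
  fixes f g :: "nat \<Rightarrow> real"
  assumes "f sums a" "g sums b" "\<And>n. f n \<le> g n" "f i < g i"
  shows "a < b"
proof -
  have "(\<lambda>n. g n - f n) sums (b - a)"
    using assms by (intro sums_diff)
  moreover from this have "0 < (\<Sum>n. g n - f n)"
    using assms by (intro suminf_pos2[where i = i]) (auto simp: sums_iff)
  ultimately show ?thesis by (simp add: sums_iff)
qed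

lemma mid_coeff_partial_sum:
  fixes x :: real
  assumes "n \<ge> 2"
  shows "(\<Sum>k<n. mid_coeff k * x ^ (2 * k)) = 2 + (\<Sum>k = 3..n.
      ((-1) ^ (k - 1) * 2 ^ (2 * k - 1) / fact (2 * k)
        + 2 ^ (2 * k) * (2 ^ (2 * k) - 1) * \<bar>bernoulli (2 * k)\<bar> / fact (2 * k)) * x ^ (2 * k - 2))"
  using assms
proof (induction n rule: dec_induct)
  case base
  \<comment> \<open>These are \<open>1 + 1\<close> and \<open>- 1/3 + 1/3\<close>; at
    \<open>n = 2\<close> the sum from 3 is empty.\<close>
  have "mid_coeff 0 = 2" "mid_coeff 1 = 0"
    using tan_coeff_1 by (simp_all add: mid_coeff_def sin2_coeff_def fact_numeral)
  then show ?case by (simp add: numeral_2_eq_2)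
next
  case (step n)
  have "mid_coeff n = (-1) ^ (Suc n - 1) * 2 ^ (2 * Suc n - 1) / fact (2 * Suc n)
        + 2 ^ (2 * Suc n) * (2 ^ (2 * Suc n) - 1) * \<bar>bernoulli (2 * Suc n)\<bar> / fact (2 * Suc n)"
    using abs_bernoulli_even_eq_tan_coeff[of n]
    by (simp add: mid_coeff_def sin2_coeff_def del: fact_Suc power_Suc)
  with step show ?case
    by (simp del: fact_Suc power_Suc)
qed

theorem theorem3p1:
  fixes x :: real and n :: nat
  assumes "0 < x" and "x < pi / 2" and "n \<ge> 3"
  shows "((-1) ^ n * 2 ^ (2 * n + 1) / fact (2 * n + 2)
            + 2 ^ (2 * n + 2) * (2 ^ (2 * n + 2) - 1) * \<bar>bernoulli (2 * n + 2)\<bar> / fact (2 * n + 2))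
          * x ^ (2 * n - 1) * tan x
        < (sin x / x)\<^sup>2 + tan x / x
          - (2 + (\<Sum>k = 3..n.
              ((-1) ^ (k - 1) * 2 ^ (2 * k - 1) / fact (2 * k)
                + 2 ^ (2 * k) * (2 ^ (2 * k) - 1) * \<bar>bernoulli (2 * k)\<bar> / fact (2 * k))
              * x ^ (2 * k - 2)))
      \<and> (sin x / x)\<^sup>2 + tan x / x
          - (2 + (\<Sum>k = 3..n.
              ((-1) ^ (k - 1) * 2 ^ (2 * k - 1) / fact (2 * k)
                + 2 ^ (2 * k) * (2 ^ (2 * k) - 1) * \<bar>bernoulli (2 * k)\<bar> / fact (2 * k))
              * x ^ (2 * k - 2)))
        < (2 / pi) ^ (2 * n) * x ^ (2 * n - 1) * tan x"
proof -
  define R where "R = (sin x / x)\<^sup>2 + tan x / x - (\<Sum>k<n. mid_coeff k * x ^ (2 * k))"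
  have "(\<lambda>k. mid_coeff k * x ^ (2 * k)) sums ((sin x / x)\<^sup>2 + tan x / x)"
    unfolding mid_coeff_def distrib_right
    using assms by (intro sums_add sin2_over_sums tan_over_sums) auto
  then have "(\<lambda>j. mid_coeff (j + n) * x ^ (2 * (j + n))) sums R"
    unfolding R_def by (rule sums_split_initial_segment)
  then have R: "(\<lambda>j. mid_coeff (n + j) * x ^ (2 * (n + j))) sums R"
    by (simp only: add.commute[of _ n])
  \<comment> \<open>Rewriting \<open>x ^ (2 * n - 1) * tan x\<close> as
    \<open>x ^ (2 * n) * (tan x / x)\<close> aligns its powers with those of
    \<open>R\<close>.\<close>
  have tan: "(\<lambda>j. c * tan_coeff j * x ^ (2 * (n + j))) sums (c * x ^ (2 * n - 1) * tan x)" for c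
  proof -
    have "(\<lambda>j. c * x ^ (2 * n) * (tan_coeff j * x ^ (2 * j))) sums (c * x ^ (2 * n) * (tan x / x))"
      using assms by (intro sums_mult tan_over_sums) auto
    moreover have "x ^ (2 * n) = x ^ (2 * n - 1) * x"
      using assms by (subst power_Suc2 [symmetric]) simp
    ultimately show ?thesis
      using assms by (simp add: power_add mult_ac)
  qed
  have lower: "mid_coeff n * x ^ (2 * n - 1) * tan x < R"
  proof (rule sums_less[OF tan R])
    show "mid_coeff n * tan_coeff j * x ^ (2 * (n + j)) \<le> mid_coeff (n + j) * x ^ (2 * (n + j))" for j
      using mid_coeff_lower[of n j] assms by (cases j) auto
    \<comment> \<open>Equality holds at index 0, so strictness is taken from index 1.\<close>
    show "mid_coeff n * tan_coeff 1 * x ^ (2 * (n + 1)) < mid_coeff (n + 1) * x ^ (2 * (n + 1))"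
      using mid_coeff_lower[of n 1] assms by (intro mult_strict_right_mono) auto
  qed
  have "R < (4 / pi\<^sup>2) ^ n * x ^ (2 * n - 1) * tan x"
  proof (rule sums_less[OF R tan])
    show less: "mid_coeff (n + j) * x ^ (2 * (n + j)) < (4 / pi\<^sup>2) ^ n * tan_coeff j * x ^ (2 * (n + j))" for j
      using mid_coeff_upper[of n j] assms by (intro mult_strict_right_mono) auto
    show "mid_coeff (n + j) * x ^ (2 * (n + j)) \<le> (4 / pi\<^sup>2) ^ n * tan_coeff j * x ^ (2 * (n + j))" for j
      using less[of j] by simp
  qed
  moreover have "(4 / pi\<^sup>2) ^ n = (2 / pi) ^ (2 * n)"
    by (simp add: power_mult power_divide)
  moreover have "mid_coeff n = (-1) ^ n * 2 ^ (2 * n + 1) / fact (2 * n + 2)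
      + 2 ^ (2 * n + 2) * (2 ^ (2 * n + 2) - 1) * \<bar>bernoulli (2 * n + 2)\<bar> / fact (2 * n + 2)"
    unfolding mid_coeff_def sin2_coeff_def abs_bernoulli_even_eq_tan_coeff ..
  ultimately show ?thesis
    using lower mid_coeff_partial_sum[of n x] assms unfolding R_def by simp
qed

end
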